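(* Let $k\ge1$ be an integer. For blocking RSA on $T_k$ and on $T_k^*$, for an arbitrary vertex $v$ of $T_k$ and $t\in[0,1]$, $$P[X_t^{T_k}(v)=0]=\tfrac12\Big(1+\big(P[X_t^{T_k^*}(v_0)=0]\big)^2\Big),$$ with $$P[X_t^{T_k^*}(v_0)=0]=\begin{cases}(1+(k-1)t)^{-1/(k-1)},&k\ge2,\\ e^{-t},&k=1.\end{cases}$$ In particular, $$P[X_1^{T_k}(v)=0]=\begin{cases}\tfrac12\big(1+k^{-2/(k-1)}\big),&k\ge2,\\ \tfrac12(1+e^{-2}),&k=1.\end{cases}$$
   Context: $T_k$ is the infinite $(k+1)$-regular tree (connected, acyclic, every vertex of degree $k+1$). $T_k^*$ is the infinite tree in which one vertex, the root $v_0$, has degree $k$ and all other vertices have degree $k+1$. Blocking RSA on a finite graph $V$: $\tau_v$, $v\in V$, are i.i.d. uniform on $(0,1)$. All sites are initially vacant (state $0$); at time $\tau_v$ site $v$ becomes occupied (state $1$) if and only if none of its neighbours is already occupied; otherwise nothing changes at that time. Occupied sites stay occupied forever. $X_t^V(v)\in\{0,1\}$ is the state of $v$ at time $t$. For countably infinite $V$ of bounded degree, $X_t^V(v):=\lim_n X_t^{V_n}(v)$, where $(V_n)$ is any sequence of finite subsets of $V$ with $\bigcup_n\bigcap_{m\ge n}V_m=V$ and the process on the induced subgraph $V_n$ uses the same $(\tau_v)$; almost surely this limit exists for all $v,t$ and does not depend on the sequence. *)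

theory Defs
  imports "HOL-Probability.Probability"
begin

definition simple_graph :: "'a set \<Rightarrow> ('a \<Rightarrow> 'a \<Rightarrow> bool) \<Rightarrow> bool" where
  "simple_graph V E \<longleftrightarrow> (\<forall>u v. E u v \<longrightarrow> u \<in> V \<and> v \<in> V \<and> u \<noteq> v \<and> E v u)"

definition graph_connected :: "'a set \<Rightarrow> ('a \<Rightarrow> 'a \<Rightarrow> bool) \<Rightarrow> bool" where
  "graph_connected V E \<longleftrightarrow> (\<forall>u\<in>V. \<forall>v\<in>V. E\<^sup>*\<^sup>* u v)"

definition graph_cycle :: "('a \<Rightarrow> 'a \<Rightarrow> bool) \<Rightarrow> 'a list \<Rightarrow> bool" where
  "graph_cycle E xs \<longleftrightarrow>
     3 \<le> length xs \<and> distinct xs \<and> successively E xs \<and> E (last xs) (hd xs)"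

definition vertex_degree :: "('a \<Rightarrow> 'a \<Rightarrow> bool) \<Rightarrow> 'a \<Rightarrow> nat" where
  "vertex_degree E v = card {u. E v u}"

definition infinite_tree :: "'a set \<Rightarrow> ('a \<Rightarrow> 'a \<Rightarrow> bool) \<Rightarrow> bool" where
  "infinite_tree V E \<longleftrightarrow>
     infinite V \<and> simple_graph V E \<and> graph_connected V E \<and> (\<nexists>xs. graph_cycle E xs)"

text \<open>
  Up to isomorphism each of the following two predicates describes exactly one graph,
  \<open>T\<^sub>k\<close> and \<open>(T\<^sub>k\<^sup>*, v\<^sub>0)\<close> respectively. For \<open>k \<ge> 1\<close> all degrees are nonzero,
  so \<^const>\<open>card\<close> also forces the neighbourhoods to be finite.
\<close>

definition is_T :: "nat \<Rightarrow> 'a set \<Rightarrow> ('a \<Rightarrow> 'a \<Rightarrow> bool) \<Rightarrow> bool" where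
  "is_T k V E \<longleftrightarrow> infinite_tree V E \<and> (\<forall>v\<in>V. vertex_degree E v = k + 1)"

definition is_T_star :: "nat \<Rightarrow> 'a set \<Rightarrow> ('a \<Rightarrow> 'a \<Rightarrow> bool) \<Rightarrow> 'a \<Rightarrow> bool" where
  "is_T_star k V E v0 \<longleftrightarrow>
     infinite_tree V E \<and> v0 \<in> V \<and> vertex_degree E v0 = k \<and> (\<forall>v\<in>V - {v0}. vertex_degree E v = k + 1)"

definition iid_uniform :: "'w measure \<Rightarrow> 'a set \<Rightarrow> ('a \<Rightarrow> 'w \<Rightarrow> real) \<Rightarrow> bool" where
  "iid_uniform M V \<tau> \<longleftrightarrow>
     prob_space M \<and>
     prob_space.indep_vars M (\<lambda>_. borel) \<tau> V \<and>
     (\<forall>v\<in>V. distr M borel (\<tau> v) = uniform_measure lborel {0<..<1})"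

text \<open>
  \<open>accepted E V \<tau> v\<close>: in the process on the finite vertex set \<open>V\<close> (with the subgraph induced
  by \<open>E\<close>) and arrival times \<open>\<tau>\<close>, the arrival at \<open>v\<close> finds no neighbour already occupied,
  i.e. no neighbour in \<open>V\<close> with an earlier, accepted arrival. The conjunct \<^term>\<open>finite V\<close>
  makes the recursion terminate. Ties have probability zero, so their treatment is immaterial.
\<close>

context
  notes conj_cong [fundef_cong]
begin

function accepted :: "('a \<Rightarrow> 'a \<Rightarrow> bool) \<Rightarrow> 'a set \<Rightarrow> ('a \<Rightarrow> real) \<Rightarrow> 'a \<Rightarrow> bool" where
  "accepted E V \<tau> v \<longleftrightarrow>
     finite V \<and> v \<in> V \<and> (\<forall>u\<in>V. E v u \<and> \<tau> u < \<tau> v \<longrightarrow> \<not> accepted E V \<tau> u)"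
  by pat_completeness auto
termination
proof (relation "Wellfounded.measure (\<lambda>(E, V, \<tau>, v). card {u\<in>V. \<tau> u < \<tau> v})", goal_cases)
  case (2 E V \<tau> v u)
  then have "{w\<in>V. \<tau> w < \<tau> u} \<subset> {w\<in>V. \<tau> w < \<tau> v}" by auto
  with 2 show ?case by (auto intro!: psubset_card_mono)
qed simp

end

declare accepted.simps [simp del]

definition rsa_finite ::
  "('a \<Rightarrow> 'a \<Rightarrow> bool) \<Rightarrow> 'a set \<Rightarrow> ('a \<Rightarrow> real) \<Rightarrow> real \<Rightarrow> 'a \<Rightarrow> nat" where
  "rsa_finite E V \<tau> t v = (if \<tau> v \<le> t \<and> accepted E V \<tau> v then 1 else 0)"

definition exhausts :: "(nat \<Rightarrow> 'a set) \<Rightarrow> 'a set \<Rightarrow> bool" where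
  "exhausts Vs V \<longleftrightarrow>
     (\<forall>n. finite (Vs n) \<and> Vs n \<subseteq> V) \<and> (\<Union>n. \<Inter>m\<in>{n..}. Vs m) = V"

text \<open>
  The state \<open>X\<^sub>t\<^sup>V(v)\<close> for countable \<open>V\<close> is the common limit along all exhausting sequences.
  It is unspecified for those \<open>\<tau>\<close> for which there is no such common limit, which is a null event
  for i.i.d. uniform times on a countable graph of bounded degree.
\<close>

definition rsa :: "('a \<Rightarrow> 'a \<Rightarrow> bool) \<Rightarrow> 'a set \<Rightarrow> ('a \<Rightarrow> real) \<Rightarrow> real \<Rightarrow> 'a \<Rightarrow> nat" where
  "rsa E V \<tau> t v =
     (THE x. \<forall>Vs. exhausts Vs V \<longrightarrow> (\<lambda>n. rsa_finite E (Vs n) \<tau> t v) \<longlonglongrightarrow> x)"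

lemma rsa_eq_rsa_finite:
  assumes "finite V"
  shows "rsa E V \<tau> t v = rsa_finite E V \<tau> t v"
proof -
  have lim: "(\<lambda>n. rsa_finite E (Vs n) \<tau> t v) \<longlonglongrightarrow> rsa_finite E V \<tau> t v"
    if ex: "exhausts Vs V" for Vs
  proof (rule tendsto_eventually)
    have "\<forall>u\<in>V. eventually (\<lambda>m. u \<in> Vs m) sequentially"
      using ex unfolding exhausts_def eventually_sequentially by blast
    then have "eventually (\<lambda>m. \<forall>u\<in>V. u \<in> Vs m) sequentially"
      by (simp add: assms eventually_ball_finite)
    then show "eventually (\<lambda>n. rsa_finite E (Vs n) \<tau> t v = rsa_finite E V \<tau> t v) sequentially"
    proof eventually_elim
      case (elim m)
      with ex have "Vs m = V" by (auto simp: exhausts_def)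
      then show ?case by simp
    qed
  qed
  have "exhausts (\<lambda>_. V) V" using assms by (auto simp: exhausts_def)
  then show ?thesis unfolding rsa_def
    using lim LIMSEQ_unique by (intro the_equality) blast+
qed

end

theory Submission
  imports Defs
begin

text \<open>
  Whether a vertex \<open>v\<close> is accepted depends only on those neighbours that arrive earlier, and for
  such a neighbour \<open>u\<close> the vertex \<open>v\<close> is in turn irrelevant, because it arrives later. On a tree,
  conditionally on the arrival time \<open>x\<close> of \<open>v\<close>, the states of the neighbours just before \<open>x\<close> are
  therefore governed by the disjoint branches that hang off \<open>v\<close>, and are independent. If every
  branch is a copy of \<open>T\<^sub>k\<^sup>*\<close> and \<open>q(x)\<close> is the probability that its root is vacant at time \<open>x\<close>,
  then a vertex with \<open>m\<close> such branches is occupied by time \<open>t\<close> with probability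
  \<open>\<integral>\<^sub>0\<^sup>t q(x)\<^sup>m dx\<close>. For the root of \<open>T\<^sub>k\<^sup>*\<close> itself \<open>m = k\<close>, so \<open>q' = - q\<^sup>k\<close> and \<open>q(0) = 1\<close>,
  whose solution is the stated formula. For a vertex of \<open>T\<^sub>k\<close> one has \<open>m = k + 1\<close>, and
  \<open>q\<^sup>k\<^sup>+\<^sup>1 = - q q' = - (q\<^sup>2 / 2)'\<close> gives the vacancy probability
  \<open>1 - (1 - q(t)\<^sup>2) / 2\<close>.

  The limit over finite vertex sets is controlled by the same recursion. Cut it off at depth \<open>n\<close>
  by declaring vertices at distance \<open>n\<close> not accepted: acceptance is antitone in the
  acceptance of the neighbours, so the cut-off answer is a lower bound for even \<open>n\<close> and an upper
  bound for odd \<open>n\<close>, simultaneously for all finite vertex sets that contain the explored vertices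
  (\<open>accepted_bounds\<close>). With the cut at depth \<open>n + 1\<close> the
  vertex is occupied by time \<open>t\<close> with probability \<open>\<integral>\<^sub>0\<^sup>t q\<^sub>n(x)\<^sup>m dx\<close>, where \<open>q\<^sub>n\<close> are the Picard iterates of the integral equation for \<open>q\<close>
  (\<open>prob_acc_upto\<close>), and these converge to \<open>q\<close> at the rate \<open>k\<^sup>n / n!\<close>
  (\<open>vacancy_iter_error\<close>). So the event that the state settles at \<open>1\<close> has probability at
  least \<open>I = \<integral>\<^sub>0\<^sup>t q(x)\<^sup>m dx\<close> and the event that it settles at \<open>0\<close> at least \<open>1 - I\<close>. These events
  are disjoint, hence both bounds are equalities: almost sure existence of the limit
  and its law come out together (\<open>prob_rsa_eq_0\<close>).
\<close>

section \<open>Acceptance decided from arrival times within a bounded distance\<close>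

text \<open>
  The acceptance recursion cut off at depth \<open>n\<close>. The set \<open>P\<close> holds neighbours to be ignored:
  empty at the starting vertex, and below it the vertex from which the recursion came, whose
  arrival is later. Ignoring that vertex makes the answer depend on a single branch of a tree.
\<close>

primrec acc_upto :: "('a \<Rightarrow> 'a \<Rightarrow> bool) \<Rightarrow> nat \<Rightarrow> 'a set \<Rightarrow> ('a \<Rightarrow> real) \<Rightarrow> 'a \<Rightarrow> bool" where
  "acc_upto E 0 P \<tau> v \<longleftrightarrow> False"
| "acc_upto E (Suc n) P \<tau> v \<longleftrightarrow>
     (\<forall>u \<in> {u. E v u} - P. \<tau> u < \<tau> v \<longrightarrow> \<not> acc_upto E n {v} \<tau> u)"

text \<open>
  The vertices whose arrival times \<open>acc_upto\<close> may consult.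
\<close>

primrec explored :: "('a \<Rightarrow> 'a \<Rightarrow> bool) \<Rightarrow> nat \<Rightarrow> 'a set \<Rightarrow> 'a \<Rightarrow> 'a set" where
  "explored E 0 P v = {v}"
| "explored E (Suc n) P v = insert v (\<Union>u \<in> {u. E v u} - P. explored E n {v} u)"

lemma self_in_explored [simp]: "v \<in> explored E n P v"
  by (cases n) auto

lemma neighbour_in_explored:
  assumes "E v u" "u \<notin> P"
  shows "u \<in> explored E (Suc n) P v"
  unfolding explored.simps using assms by (intro insertI2 UN_I[of u]) auto

lemma acc_upto_cong:
  assumes "\<And>w. w \<in> explored E n P v \<Longrightarrow> \<tau> w = \<tau>' w"
  shows "acc_upto E n P \<tau> v \<longleftrightarrow> acc_upto E n P \<tau>' v"
  using assms
proof (induction n arbitrary: P v)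
  case (Suc n)
  have "acc_upto E n {v} \<tau> u \<longleftrightarrow> acc_upto E n {v} \<tau>' u" if "u \<in> {u. E v u} - P" for u
    using Suc.prems that by (intro Suc.IH) auto
  moreover have "\<tau> u = \<tau>' u" if "u \<in> {u. E v u} - P" for u
    using that by (intro Suc.prems neighbour_in_explored) auto
  ultimately show ?case using Suc.prems[of v] by auto
qed simp

lemma finite_explored:
  assumes "\<And>w. finite {u. E w u}"
  shows "finite (explored E n P v)"
  using assms by (induction n arbitrary: P v) auto

lemma explored_subset:
  assumes "\<And>x y. E x y \<Longrightarrow> y \<in> W" and "v \<in> W"
  shows "explored E n P v \<subseteq> W"
  using assms(2)
proof (induction n arbitrary: P v)
  case (Suc n)
  then show ?case using assms(1) by fastforce
qed simp

lemma measurable_acc_upto: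
  assumes "\<And>w. finite {u. E w u}"
    and "\<And>w. w \<in> explored E n P v \<Longrightarrow> (\<lambda>x. f x w) \<in> borel_measurable N"
  shows "Measurable.pred N (\<lambda>x. acc_upto E n P (f x) v)"
  using assms(2)
proof (induction n arbitrary: P v)
  case (Suc n)
  have v: "(\<lambda>x. f x v) \<in> borel_measurable N" by (rule Suc.prems) simp
  have u: "(\<lambda>x. f x u) \<in> borel_measurable N" if "u \<in> {u. E v u} - P" for u
    using that by (intro Suc.prems neighbour_in_explored) auto
  have a: "Measurable.pred N (\<lambda>x. acc_upto E n {v} (f x) u)" if "u \<in> {u. E v u} - P" for u
    using Suc.prems that by (intro Suc.IH) auto
  have "Measurable.pred N (\<lambda>x. f x u < f x v \<longrightarrow> \<not> acc_upto E n {v} (f x) u)"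
    if "u \<in> {u. E v u} - P" for u
    using v u[OF that] a[OF that] by measurable
  then show ?case
    unfolding acc_upto.simps using assms(1)[of v] by (intro pred_intros_finite) auto
qed simp

text \<open>
  The value \<open>False\<close> at depth \<open>0\<close> is a lower bound, and each further level negates the bounds for
  the neighbours, so that lower and upper bounds alternate. The neighbours in \<open>P\<close> do no harm since they
  arrive no earlier than \<open>v\<close>.
\<close>

lemma accepted_bounds:
  assumes "finite W" "explored E n P v \<subseteq> W" "\<And>p. p \<in> P \<Longrightarrow> \<tau> v \<le> \<tau> p"
  shows "(even n \<longrightarrow> acc_upto E n P \<tau> v \<longrightarrow> accepted E W \<tau> v) \<and>
         (odd n \<longrightarrow> accepted E W \<tau> v \<longrightarrow> acc_upto E n P \<tau> v)"
  using assms(2,3)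
proof (induction n arbitrary: P v)
  case (Suc n)
  have IH: "(even n \<longrightarrow> acc_upto E n {v} \<tau> u \<longrightarrow> accepted E W \<tau> u) \<and>
         (odd n \<longrightarrow> accepted E W \<tau> u \<longrightarrow> acc_upto E n {v} \<tau> u)"
    if "E v u" "u \<notin> P" "\<tau> u < \<tau> v" for u
    using Suc.prems that by (intro Suc.IH) auto
  have inW: "u \<in> W" if "E v u" "u \<notin> P" for u
    using Suc.prems(1) neighbour_in_explored[of E v u P n] that by blast
  have nP: "u \<notin> P" if "\<tau> u < \<tau> v" for u
    using Suc.prems(2)[of u] that by auto
  have acc: "accepted E W \<tau> v \<longleftrightarrow> (\<forall>u \<in> {u. E v u} - P. \<tau> u < \<tau> v \<longrightarrow> \<not> accepted E W \<tau> u)"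
    using Suc.prems(1) assms(1) inW nP by (subst accepted.simps) auto
  show ?case unfolding acc acc_upto.simps using IH by auto
qed simp

text \<open>
  On a finite vertex set arrival times strictly decrease along the recursion, so that a depth
  exceeding the number of earlier arrivals is enough. This turns the recursion over arrival times,
  which differs from sample to sample, into one of fixed depth, to which measurability arguments apply.
\<close>

lemma accepted_eq_acc_upto:
  assumes "finite W" "v \<in> W" "\<And>p. p \<in> P \<Longrightarrow> \<tau> v \<le> \<tau> p" "card {u \<in> W. \<tau> u < \<tau> v} < n"
  shows "accepted E W \<tau> v \<longleftrightarrow> acc_upto (\<lambda>x y. E x y \<and> y \<in> W) n P \<tau> v"
  using assms(2-4)
proof (induction n arbitrary: P v)
  case (Suc n)
  have IH: "accepted E W \<tau> u \<longleftrightarrow> acc_upto (\<lambda>x y. E x y \<and> y \<in> W) n {v} \<tau> u"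
    if "u \<in> W" "\<tau> u < \<tau> v" for u
  proof (rule Suc.IH)
    have "{w \<in> W. \<tau> w < \<tau> u} \<subset> {w \<in> W. \<tau> w < \<tau> v}" using that by auto
    then have "card {w \<in> W. \<tau> w < \<tau> u} < card {w \<in> W. \<tau> w < \<tau> v}"
      using assms(1) by (intro psubset_card_mono) auto
    then show "card {w \<in> W. \<tau> w < \<tau> u} < n" using Suc.prems by simp
  qed (use that in auto)
  have nP: "u \<notin> P" if "\<tau> u < \<tau> v" for u
    using Suc.prems(2)[of u] that by auto
  show ?case
    using Suc.prems assms(1) IH nP by (subst accepted.simps) auto
qed simp

lemma measurable_accepted:
  assumes "finite W" "\<And>w. w \<in> W \<Longrightarrow> (\<lambda>x. f x w) \<in> borel_measurable N"
  shows "Measurable.pred N (\<lambda>x. accepted E W (f x) v)"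
proof (cases "v \<in> W")
  case True
  let ?E = "\<lambda>x y. E x y \<and> y \<in> W"
  \<comment> \<open>The vertex \<open>v\<close> does not arrive before itself, so depth \<open>card W\<close> suffices for all arrival times.\<close>
  have "card {u \<in> W. \<tau> u < \<tau> v} < card W" for \<tau> :: "'a \<Rightarrow> real"
    using True assms(1) by (intro psubset_card_mono) auto
  then have "(\<lambda>x. accepted E W (f x) v) = (\<lambda>x. acc_upto ?E (card W) {} (f x) v)"
    by (intro ext accepted_eq_acc_upto[OF assms(1) True]) auto
  moreover have "Measurable.pred N (\<lambda>x. acc_upto ?E (card W) {} (f x) v)"
    using assms explored_subset[of ?E W v "card W" "{}"] True
    by (intro measurable_acc_upto) auto
  ultimately show ?thesis by simp
next
  case False
  then have "\<not> accepted E W (f x) v" for x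
    by (simp add: accepted.simps[of E W "f x" v])
  then show ?thesis by simp
qed

section \<open>The limit over exhausting sequences\<close>

text \<open>
  Convergence along the directed family of finite subsets of \<open>V\<close>. For countable \<open>V\<close> it
  quantifies over countably many sets only, unlike the definition through all exhausting sequences.
\<close>

definition settles :: "('a \<Rightarrow> 'a \<Rightarrow> bool) \<Rightarrow> 'a set \<Rightarrow> ('a \<Rightarrow> real) \<Rightarrow> real \<Rightarrow> 'a \<Rightarrow> nat \<Rightarrow> bool" where
  "settles E V \<tau> t v x \<longleftrightarrow>
     (\<exists>F \<in> {F. finite F \<and> F \<subseteq> V}. \<forall>W \<in> {W. finite W \<and> W \<subseteq> V}. F \<subseteq> W \<longrightarrow> rsa_finite E W \<tau> t v = x)"

text \<open>
  If the state does not settle, then every finite set has a finite superset with the wrong state;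
  choosing such supersets of the first \<open>n\<close> vertices yields an exhausting sequence
  without the limit \<open>x\<close>.
\<close>

lemma settles_iff_limit:
  assumes "countable V"
  shows "settles E V \<tau> t v x \<longleftrightarrow>
     (\<forall>Vs. exhausts Vs V \<longrightarrow> (\<lambda>n. rsa_finite E (Vs n) \<tau> t v) \<longlonglongrightarrow> x)"
proof (intro iffI allI impI)
  fix Vs assume "settles E V \<tau> t v x" and ex: "exhausts Vs V"
  then obtain F where F: "finite F" "F \<subseteq> V"
    and x: "\<And>W. finite W \<Longrightarrow> W \<subseteq> V \<Longrightarrow> F \<subseteq> W \<Longrightarrow> rsa_finite E W \<tau> t v = x"
    by (auto simp: settles_def)
  have sub: "finite (Vs n)" "Vs n \<subseteq> V" for n
    using ex by (auto simp: exhausts_def)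
  have "eventually (\<lambda>m. u \<in> Vs m) sequentially" if "u \<in> F" for u
  proof -
    have "u \<in> (\<Union>n. \<Inter>m\<in>{n..}. Vs m)" using that F(2) ex by (auto simp: exhausts_def)
    then show ?thesis by (auto simp: eventually_sequentially)
  qed
  then have "eventually (\<lambda>m. \<forall>u\<in>F. u \<in> Vs m) sequentially"
    by (simp add: F eventually_ball_finite)
  then have "eventually (\<lambda>n. rsa_finite E (Vs n) \<tau> t v = x) sequentially"
  proof eventually_elim
    case (elim n)
    then show ?case using sub[of n] by (intro x) auto
  qed
  then show "(\<lambda>n. rsa_finite E (Vs n) \<tau> t v) \<longlonglongrightarrow> x"
    by (rule tendsto_eventually)
next
  assume lim: "\<forall>Vs. exhausts Vs V \<longrightarrow> (\<lambda>n. rsa_finite E (Vs n) \<tau> t v) \<longlonglongrightarrow> x"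
  show "settles E V \<tau> t v x"
  proof (rule ccontr)
    assume neg: "\<not> settles E V \<tau> t v x"
    define F where "F n = {u \<in> V. to_nat_on V u < n}" for n
    have finF: "finite (F n)" for n
    proof -
      have "inj_on (to_nat_on V) (F n)"
        using assms inj_on_to_nat_on inj_on_subset by (fastforce simp: F_def)
      moreover have "to_nat_on V ` F n \<subseteq> {..<n}" by (auto simp: F_def)
      ultimately show ?thesis by (meson finite_imageD finite_lessThan finite_subset)
    qed
    have "\<exists>W. finite W \<and> W \<subseteq> V \<and> F n \<subseteq> W \<and> rsa_finite E W \<tau> t v \<noteq> x" for n
      using neg finF[of n] unfolding settles_def by (auto simp: F_def)
    then obtain W where W: "\<And>n. finite (W n)" "\<And>n. W n \<subseteq> V" "\<And>n. F n \<subseteq> W n"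
      and neq: "\<And>n. rsa_finite E (W n) \<tau> t v \<noteq> x" by metis
    have "u \<in> (\<Union>n. \<Inter>m\<in>{n..}. W m)" if "u \<in> V" for u
      using W(3) that by (intro UN_I[of "Suc (to_nat_on V u)"]) (auto simp: F_def subset_iff)
    moreover have "(\<Union>n. \<Inter>m\<in>{n..}. W m) \<subseteq> V"
      using W(2) by blast
    ultimately have "exhausts W V" using W(1,2) unfolding exhausts_def by blast
    with lim have "(\<lambda>n. rsa_finite E (W n) \<tau> t v) \<longlonglongrightarrow> x" by blast
    then have "eventually (\<lambda>n. rsa_finite E (W n) \<tau> t v = x) sequentially"
      by (simp add: tendsto_discrete)
    with neq show False by simp
  qed
qed

lemma rsa_alt: "countable V \<Longrightarrow> rsa E V \<tau> t v = (THE x. settles E V \<tau> t v x)"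
  by (simp add: rsa_def settles_iff_limit)

lemma settles_unique: "settles E V \<tau> t v x \<Longrightarrow> settles E V \<tau> t v y \<Longrightarrow> x = y"
proof -
  assume "settles E V \<tau> t v x" "settles E V \<tau> t v y"
  then obtain F G where "finite F" "F \<subseteq> V" "finite G" "G \<subseteq> V"
    "\<And>W. finite W \<Longrightarrow> W \<subseteq> V \<Longrightarrow> F \<subseteq> W \<Longrightarrow> rsa_finite E W \<tau> t v = x"
    "\<And>W. finite W \<Longrightarrow> W \<subseteq> V \<Longrightarrow> G \<subseteq> W \<Longrightarrow> rsa_finite E W \<tau> t v = y"
    unfolding settles_def by auto
  from this(5)[of "F \<union> G"] this(6)[of "F \<union> G"] this(1-4) show "x = y"
    by (metis Un_subset_iff finite_Un sup_ge1 sup_ge2)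
qed

lemma rsa_eqI: "countable V \<Longrightarrow> settles E V \<tau> t v x \<Longrightarrow> rsa E V \<tau> t v = x"
  by (metis rsa_alt settles_unique the_equality)

lemma settles_0_or_1: "settles E V \<tau> t v x \<Longrightarrow> x = 0 \<or> x = 1"
  unfolding settles_def by (auto simp: rsa_finite_def split: if_splits)

lemma measurable_settles:
  assumes "countable V" "\<And>w. w \<in> V \<Longrightarrow> (\<lambda>\<omega>. f \<omega> w) \<in> borel_measurable N" "v \<in> V"
  shows "Measurable.pred N (\<lambda>\<omega>. settles E V (f \<omega>) t v x)"
proof -
  have c: "countable {F. finite F \<and> F \<subseteq> V}"
    using assms(1) by (rule countable_Collect_finite_subset)
  have "Measurable.pred N (\<lambda>\<omega>. rsa_finite E W (f \<omega>) t v = x)" if "finite W" "W \<subseteq> V" for W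
  proof -
    have [measurable]: "Measurable.pred N (\<lambda>\<omega>. accepted E W (f \<omega>) v)"
      using that assms(2) by (intro measurable_accepted) auto
    have [measurable]: "(\<lambda>\<omega>. f \<omega> v) \<in> borel_measurable N" using assms by blast
    show ?thesis unfolding rsa_finite_def by measurable
  qed
  then have "Measurable.pred N (\<lambda>\<omega>. F \<subseteq> W \<longrightarrow> rsa_finite E W (f \<omega>) t v = x)"
    if "W \<in> {W. finite W \<and> W \<subseteq> V}" for F W
    using that by (cases "F \<subseteq> W") auto
  then show ?thesis
    unfolding settles_def using c by (intro measurable_pred_countable) auto
qed

lemma settles_if_acc_upto:
  assumes "\<And>w. finite {u. E w u}" "explored E n {} v \<subseteq> V"
  shows "even n \<Longrightarrow> \<tau> v \<le> t \<Longrightarrow> acc_upto E n {} \<tau> v \<Longrightarrow> settles E V \<tau> t v 1"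
    and "odd n \<Longrightarrow> \<not> (\<tau> v \<le> t \<and> acc_upto E n {} \<tau> v) \<Longrightarrow> settles E V \<tau> t v 0"
proof -
  have fin: "finite (explored E n {} v)" using assms(1) by (rule finite_explored)
  have b: "(even n \<longrightarrow> acc_upto E n {} \<tau> v \<longrightarrow> accepted E W \<tau> v) \<and>
         (odd n \<longrightarrow> accepted E W \<tau> v \<longrightarrow> acc_upto E n {} \<tau> v)"
    if "finite W" "explored E n {} v \<subseteq> W" for W
    using that by (intro accepted_bounds) auto
  show "settles E V \<tau> t v 1" if "even n" "\<tau> v \<le> t" "acc_upto E n {} \<tau> v"
    unfolding settles_def rsa_finite_def
    by (rule bexI[of _ "explored E n {} v"]) (use that b fin assms(2) in auto)
  show "settles E V \<tau> t v 0" if "odd n" "\<not> (\<tau> v \<le> t \<and> acc_upto E n {} \<tau> v)"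
    unfolding settles_def rsa_finite_def
    by (rule bexI[of _ "explored E n {} v"]) (use that b fin assms(2) in auto)
qed

section \<open>Branches of an acyclic graph\<close>

text \<open>
  The vertices reachable from \<open>v\<close> by a walk that does not step into \<open>P\<close>.
  With \<open>P = {p}\<close> for a neighbour \<open>p\<close> of \<open>v\<close> in a tree, this is the part of the tree on the far side
  of the edge from \<open>p\<close> to \<open>v\<close>.
\<close>

definition branch :: "('a \<Rightarrow> 'a \<Rightarrow> bool) \<Rightarrow> 'a set \<Rightarrow> 'a \<Rightarrow> 'a set" where
  "branch E P v = {w. (\<lambda>x y. E x y \<and> y \<notin> P)\<^sup>*\<^sup>* v w}"

lemma self_in_branch: "v \<in> branch E P v"
  by (simp add: branch_def)

lemma branch_step: "x \<in> branch E P v \<Longrightarrow> E x y \<Longrightarrow> y \<notin> P \<Longrightarrow> y \<in> branch E P v"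
  unfolding branch_def by (auto intro: rtranclp.rtrancl_into_rtrancl)

lemma branch_subset_vertices:
  assumes "simple_graph V E" "v \<in> V"
  shows "branch E P v \<subseteq> V"
proof
  fix w assume "w \<in> branch E P v"
  then have "(\<lambda>x y. E x y \<and> y \<notin> P)\<^sup>*\<^sup>* v w" by (simp add: branch_def)
  then show "w \<in> V" by induction (use assms in \<open>auto simp: simple_graph_def\<close>)
qed

lemma branch_avoids:
  assumes "w \<in> branch E P v" "v \<notin> P"
  shows "w \<notin> P"
  using assms unfolding branch_def by (auto elim: rtranclp.cases)

lemma branch_sym:
  assumes "simple_graph V E" "w \<in> branch E P v" "v \<notin> P"
  shows "v \<in> branch E P w"
proof -
  have "(\<lambda>x y. E x y \<and> y \<notin> P)\<^sup>*\<^sup>* v w" using assms(2) by (simp add: branch_def)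
  then have "w \<notin> P \<and> (\<lambda>x y. E x y \<and> y \<notin> P)\<^sup>*\<^sup>* w v"
  proof induction
    case base then show ?case using assms(3) by simp
  next
    case (step y z)
    moreover have "E z y" using assms(1) step by (auto simp: simple_graph_def)
    ultimately show ?case by (auto intro: converse_rtranclp_into_rtranclp)
  qed
  then show ?thesis by (simp add: branch_def)
qed

lemma branch_trans: "w \<in> branch E P v \<Longrightarrow> x \<in> branch E P w \<Longrightarrow> x \<in> branch E P v"
  unfolding branch_def by auto

lemma path_in_branch:
  assumes "w \<in> branch E P v" "v \<notin> P"
  obtains xs where "xs \<noteq> []" "distinct xs" "successively E xs" "hd xs = v" "last xs = w" "set xs \<inter> P = {}"
proof -
  have "(\<lambda>x y. E x y \<and> y \<notin> P)\<^sup>*\<^sup>* v w" using assms(1) by (simp add: branch_def)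
  then have "\<exists>xs. xs \<noteq> [] \<and> distinct xs \<and> successively E xs \<and> hd xs = v \<and> last xs = w \<and> set xs \<inter> P = {}"
  proof induction
    case base
    then show ?case using assms(2) by (intro exI[of _ "[v]"]) auto
  next
    case (step y z)
    then obtain xs where xs: "xs \<noteq> []" "distinct xs" "successively E xs" "hd xs = v" "last xs = y"
      "set xs \<inter> P = {}" by blast
    show ?case
    \<comment> \<open>A revisited vertex is handled by cutting the path at its earlier visit.\<close>
    proof (cases "z \<in> set xs")
      case True
      then obtain ys zs where "xs = ys @ z # zs" by (meson split_list)
      with xs show ?thesis
        by (intro exI[of _ "ys @ [z]"]) (auto simp: successively_append_iff hd_append split: if_splits)
    next
      case False
      with xs step show ?thesis
        by (intro exI[of _ "xs @ [z]"]) (auto simp: successively_append_iff)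
    qed
  qed
  then show ?thesis using that by blast
qed

text \<open>
  A path between two neighbours of \<open>v\<close> that avoids \<open>v\<close> would close up to a cycle through \<open>v\<close>.
\<close>

lemma neighbours_separated:
  assumes "simple_graph V E" "\<nexists>xs. graph_cycle E xs" "E v u" "E v u'" "u' \<in> branch E {v} u"
  shows "u = u'"
proof (rule ccontr)
  assume neq: "u \<noteq> u'"
  have "u \<noteq> v" using assms(1,3) by (auto simp: simple_graph_def)
  then obtain xs where xs: "xs \<noteq> []" "distinct xs" "successively E xs" "hd xs = u" "last xs = u'"
    "set xs \<inter> {v} = {}" using path_in_branch[OF assms(5)] by blast
  have "length xs \<ge> 2"
    using xs(1,4,5) neq by (cases xs; cases "tl xs") auto
  moreover have "E u' v" using assms(1,4) by (auto simp: simple_graph_def)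
  ultimately have "graph_cycle E (v # xs)"
    using xs assms(3) by (auto simp: graph_cycle_def successively_Cons)
  with assms(2) show False by blast
qed

lemma branches_disjoint:
  assumes "simple_graph V E" "\<nexists>xs. graph_cycle E xs" "E v u" "E v u'" "u \<noteq> u'"
  shows "branch E {v} u \<inter> branch E {v} u' = {}"
proof (rule ccontr)
  assume "\<not> ?thesis"
  then obtain w where w: "w \<in> branch E {v} u" "w \<in> branch E {v} u'" by blast
  have "u' \<noteq> v" using assms(1,4) by (auto simp: simple_graph_def)
  then have "u' \<in> branch E {v} w" using branch_sym[OF assms(1) w(2)] by simp
  then show False using branch_trans[OF w(1)] neighbours_separated[OF assms(1-4)] assms(5) by blast
qed

text \<open>
  A walk in the branch of the child \<open>u\<close> cannot reach a vertex of \<open>P\<close>, since that would be a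
  second neighbour of \<open>v\<close> reached without passing through \<open>v\<close>.
\<close>

lemma subbranch_subset:
  assumes "simple_graph V E" "\<nexists>xs. graph_cycle E xs" "P \<subseteq> {u. E v u}" "E v u" "u \<notin> P"
  shows "branch E {v} u \<subseteq> branch E P v"
proof
  fix w assume "w \<in> branch E {v} u"
  then have "(\<lambda>x y. E x y \<and> y \<notin> {v})\<^sup>*\<^sup>* u w" by (simp add: branch_def)
  then show "w \<in> branch E P v"
  proof induction
    case base
    show ?case by (rule branch_step[OF self_in_branch]) (use assms(4,5) in auto)
  next
    case (step y z)
    have "z \<in> branch E {v} u"
      using step(1,2) unfolding branch_def by (auto intro: rtranclp.rtrancl_into_rtrancl)
    then have "z \<notin> P"
      using neighbours_separated[OF assms(1,2,4)] assms(3,5) by blast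
    with step show ?case by (auto intro: branch_step)
  qed
qed

lemma explored_subset_branch:
  assumes "simple_graph V E" "\<nexists>xs. graph_cycle E xs" "P \<subseteq> {u. E v u}"
  shows "explored E n P v \<subseteq> branch E P v"
  using assms(3)
proof (induction n arbitrary: P v)
  case (Suc n)
  have "explored E n {v} u \<subseteq> branch E P v" if "u \<in> {u. E v u} - P" for u
  proof -
    have "{v} \<subseteq> {w. E u w}" using assms(1) that by (auto simp: simple_graph_def)
    then have "explored E n {v} u \<subseteq> branch E {v} u" by (rule Suc.IH)
    also have "\<dots> \<subseteq> branch E P v"
      using subbranch_subset[OF assms(1,2) Suc.prems] that by blast
    finally show ?thesis .
  qed
  then show ?case by (auto simp: self_in_branch)
qed (simp add: self_in_branch)

lemma countable_connected_locally_finite: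
  assumes "graph_connected V E" "\<And>w. finite {u. E w u}"
  shows "countable V"
proof (cases "V = {}")
  case False
  then obtain v where v: "v \<in> V" by blast
  let ?R = "{(x, y). E x y}"
  have "countable (?R\<^sup>* `` {v})"
  proof (rule countable_rtrancl)
    fix Y :: "'a set" assume "countable Y"
    moreover have "?R `` Y = (\<Union>x\<in>Y. {u. E x u})" by auto
    ultimately show "countable (?R `` Y)" using assms(2) by (metis countable_UN countable_finite)
  qed simp
  moreover have "V \<subseteq> ?R\<^sup>* `` {v}"
    using assms(1) v by (auto simp: graph_connected_def Enum.rtranclp_rtrancl_eq)
  ultimately show ?thesis by (rule countable_subset[rotated])
qed simp

section \<open>The integral equation for the vacancy probability\<close>

text \<open>
  The Picard iterates of \<open>q(s) = 1 - \<integral>\<^sub>0\<^sup>s q(x)\<^sup>k dx\<close>.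
\<close>

primrec vacancy_iter :: "nat \<Rightarrow> nat \<Rightarrow> real \<Rightarrow> real" where
  "vacancy_iter k 0 = (\<lambda>s. 1)"
| "vacancy_iter k (Suc n) = (\<lambda>s. 1 - integral {0..s} (\<lambda>x. vacancy_iter k n x ^ k))"

definition vacancy :: "nat \<Rightarrow> real \<Rightarrow> real" where
  "vacancy k t = (if k \<ge> 2 then (1 + (real k - 1) * t) powr (- 1 / (real k - 1)) else exp (- t))"

lemma continuous_vacancy_iter: "continuous_on {0..1} (vacancy_iter k n)"
proof (induction n)
  case (Suc n)
  have "(\<lambda>x. vacancy_iter k n x ^ k) integrable_on {0..1}"
    by (intro integrable_continuous_real continuous_intros Suc)
  then show ?case
    by (auto intro!: continuous_intros indefinite_integral_continuous_1)
qed simp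

lemma integrable_vacancy_iter_power:
  assumes "s \<in> {0..1}"
  shows "(\<lambda>x. vacancy_iter k n x ^ m) integrable_on {0..s}"
  using assms continuous_on_subset[OF continuous_vacancy_iter]
  by (intro integrable_continuous_real continuous_intros) auto

lemma vacancy_iter_bounds: "s \<in> {0..1} \<Longrightarrow> 0 \<le> vacancy_iter k n s \<and> vacancy_iter k n s \<le> 1"
proof (induction n arbitrary: s)
  case (Suc n)
  have int: "(\<lambda>x. vacancy_iter k n x ^ k) integrable_on {0..s}"
    using Suc.prems by (rule integrable_vacancy_iter_power)
  have x: "0 \<le> vacancy_iter k n x ^ k" "vacancy_iter k n x ^ k \<le> 1" if "x \<in> {0..s}" for x
    using Suc.IH[of x] Suc.prems that by (auto intro: power_le_one)
  have "integral {0..s} (\<lambda>x. vacancy_iter k n x ^ k) \<le> integral {0..s} (\<lambda>x. 1)"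
    using x int by (intro integral_le) auto
  moreover have "0 \<le> integral {0..s} (\<lambda>x. vacancy_iter k n x ^ k)"
    using x int by (intro integral_nonneg) auto
  ultimately show ?case using Suc.prems by auto
qed simp

lemma vacancy_bounds:
  assumes "k \<ge> 1" "0 \<le> t"
  shows "0 \<le> vacancy k t" "vacancy k t \<le> 1"
proof -
  show "0 \<le> vacancy k t" by (simp add: vacancy_def)
  have "(1 + (real k - 1) * t) powr (- 1 / (real k - 1)) \<le> 1" if "k \<ge> 2"
  proof -
    have b: "1 \<le> 1 + (real k - 1) * t" using that assms by simp
    then have "(1 + (real k - 1) * t) powr (- 1 / (real k - 1)) \<le> (1 + (real k - 1) * t) powr 0"
      using that by (intro powr_mono) auto
    also have "\<dots> = 1" using b by simp
    finally show ?thesis .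
  qed
  then show "vacancy k t \<le> 1" using assms by (simp add: vacancy_def)
qed

lemma vacancy_0: "vacancy k 0 = 1"
  by (simp add: vacancy_def)

text \<open>
  The two cases of \<open>vacancy\<close> solve one and the same differential equation, so that the
  analysis of the Picard iterates need not distinguish them.
\<close>

lemma vacancy_ode:
  assumes "k \<ge> 1" "0 \<le> t"
  shows "(vacancy k has_real_derivative - (vacancy k t ^ k)) (at t within A)"
proof (cases "k \<ge> 2")
  case True
  define c where "c = real k - 1"
  have c: "c > 0" "real k = c + 1" using True by (auto simp: c_def)
  have pos: "1 + c * t > 0" using c assms by (simp add: add_pos_nonneg)
  have pw: "(1 + c * t) powr (- 1 / c - 1) = ((1 + c * t) powr (- 1 / c)) ^ k"
  proof -
    have "((1 + c * t) powr (- 1 / c)) ^ k = (1 + c * t) powr (- 1 / c * real k)"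
      using pos by (simp add: powr_powr powr_realpow[symmetric])
    also have "- 1 / c * real k = - 1 / c - 1"
      using c by (simp add: field_simps)
    finally show ?thesis by simp
  qed
  have "((\<lambda>t. (1 + c * t) powr (- 1 / c)) has_real_derivative
      - ((1 + c * t) powr (- 1 / c - 1))) (at t within A)"
    using pos c by (auto intro!: derivative_eq_intros simp: field_simps)
  then show ?thesis using True pw unfolding c_def by (simp add: vacancy_def[abs_def])
next
  case False
  then have "k = 1" using assms by simp
  then show ?thesis
    by (auto simp: vacancy_def[abs_def] intro!: derivative_eq_intros)
qed

lemma continuous_vacancy: "k \<ge> 1 \<Longrightarrow> continuous_on {0..t} (vacancy k)"
  by (intro DERIV_continuous_on[OF vacancy_ode]) auto

text \<open>
  By the differential equation, antiderivatives of \<open>q\<^sup>k\<close> and \<open>q\<^sup>k\<^sup>+\<^sup>1\<close> are \<open>- q\<close> and \<open>- q\<^sup>2 / 2\<close>.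
\<close>

lemma integral_vacancy_power:
  assumes "k \<ge> 1" "0 \<le> t"
  shows "((\<lambda>x. vacancy k x ^ k) has_integral 1 - vacancy k t) {0..t}"
    and "((\<lambda>x. vacancy k x ^ (k + 1)) has_integral (1 - (vacancy k t)\<^sup>2) / 2) {0..t}"
proof -
  have "((\<lambda>x. vacancy k x ^ k) has_integral (- vacancy k t - (- vacancy k 0))) {0..t}"
    using assms vacancy_ode[OF assms(1)]
    by (intro fundamental_theorem_of_calculus)
      (auto simp: has_real_derivative_iff_has_vector_derivative[symmetric] intro!: derivative_eq_intros)
  then show "((\<lambda>x. vacancy k x ^ k) has_integral 1 - vacancy k t) {0..t}"
    by (simp add: vacancy_0)
  have "((\<lambda>x. vacancy k x ^ (k + 1)) has_integral (- (vacancy k t)\<^sup>2 / 2 - (- (vacancy k 0)\<^sup>2 / 2))) {0..t}"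
    using assms vacancy_ode[OF assms(1)]
    by (intro fundamental_theorem_of_calculus)
      (auto simp: has_real_derivative_iff_has_vector_derivative[symmetric] intro!: derivative_eq_intros)
  then show "((\<lambda>x. vacancy k x ^ (k + 1)) has_integral (1 - (vacancy k t)\<^sup>2) / 2) {0..t}"
    by (simp add: vacancy_0 diff_divide_distrib)
qed

text \<open>
  On \<open>[-1, 1]\<close> the \<open>m\<close>-th power is Lipschitz with constant \<open>m\<close>.
\<close>

lemma integral_power_diff_le:
  fixes f g h :: "real \<Rightarrow> real"
  assumes "continuous_on {0..s} f" "continuous_on {0..s} g"
    and "\<And>x. x \<in> {0..s} \<Longrightarrow> \<bar>f x\<bar> \<le> 1" "\<And>x. x \<in> {0..s} \<Longrightarrow> \<bar>g x\<bar> \<le> 1"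
    and "\<And>x. x \<in> {0..s} \<Longrightarrow> \<bar>f x - g x\<bar> \<le> h x" "(h has_integral I) {0..s}"
  shows "\<bar>integral {0..s} (\<lambda>x. f x ^ m) - integral {0..s} (\<lambda>x. g x ^ m)\<bar> \<le> real m * I"
proof -
  have fg: "(\<lambda>x. f x ^ m) integrable_on {0..s}" "(\<lambda>x. g x ^ m) integrable_on {0..s}"
    using assms(1,2) by (auto intro!: integrable_continuous_real continuous_intros)
  have h: "((\<lambda>x. real m * h x) has_integral real m * I) {0..s}"
    using assms(6) by (rule has_integral_mult_right)
  have "norm (integral {0..s} (\<lambda>x. f x ^ m - g x ^ m)) \<le> integral {0..s} (\<lambda>x. real m * h x)"
  proof (rule integral_norm_bound_integral)
    fix x assume x: "x \<in> {0..s}"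
    have "norm (f x ^ m - g x ^ m) \<le> real m * norm (f x - g x)"
      using assms(3,4)[OF x] by (intro norm_power_diff) auto
    also have "\<dots> \<le> real m * h x"
      using assms(5)[OF x] by (intro mult_left_mono) auto
    finally show "norm (f x ^ m - g x ^ m) \<le> real m * h x" .
  qed (use fg h in \<open>auto intro: integrable_diff\<close>)
  then show ?thesis using fg integral_unique[OF h] by (simp only: integral_diff real_norm_def)
qed

text \<open>
  The usual Picard estimate: each iteration integrates the error once and costs the Lipschitz
  factor \<open>k\<close>.
\<close>

lemma vacancy_iter_error:
  assumes "k \<ge> 1" "s \<in> {0..1}"
  shows "\<bar>vacancy_iter k n s - vacancy k s\<bar> \<le> (real k * s) ^ n / fact n"
  using assms(2)
proof (induction n arbitrary: s)
  case 0
  then show ?case using vacancy_bounds[of k s] assms(1) by simp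
next
  case (Suc n)
  have "((\<lambda>x. real k ^ n / fact (Suc n) * x ^ Suc n) has_real_derivative (real k * x) ^ n / fact n)
      (at x within {0..s})" for x
    using DERIV_cmult[OF DERIV_subset[OF DERIV_pow[of "Suc n" x] subset_UNIV], of "real k ^ n / fact (Suc n)" "{0..s}"]
    by (simp add: power_mult_distrib del: of_nat_Suc power_Suc)
  then have "((\<lambda>x. (real k * x) ^ n / fact n) has_integral
      real k ^ n / fact (Suc n) * s ^ Suc n - real k ^ n / fact (Suc n) * 0 ^ Suc n) {0..s}"
    using Suc.prems
    by (intro fundamental_theorem_of_calculus)
      (simp_all only: has_real_derivative_iff_has_vector_derivative atLeastAtMost_iff)
  then have h: "((\<lambda>x. (real k * x) ^ n / fact n) has_integral real k ^ n * s ^ Suc n / fact (Suc n)) {0..s}"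
    by simp
  have "\<bar>integral {0..s} (\<lambda>x. vacancy_iter k n x ^ k) - integral {0..s} (\<lambda>x. vacancy k x ^ k)\<bar>
      \<le> real k * (real k ^ n * s ^ Suc n / fact (Suc n))"
  proof (rule integral_power_diff_le[OF _ _ _ _ _ h])
    show "continuous_on {0..s} (vacancy_iter k n)"
      using Suc.prems by (intro continuous_on_subset[OF continuous_vacancy_iter]) auto
    show "continuous_on {0..s} (vacancy k)" using assms(1) by (rule continuous_vacancy)
    fix x assume x: "x \<in> {0..s}"
    then have x1: "x \<in> {0..1}" using Suc.prems by auto
    show "\<bar>vacancy_iter k n x\<bar> \<le> 1" using vacancy_iter_bounds[OF x1] by auto
    show "\<bar>vacancy k x\<bar> \<le> 1" using vacancy_bounds[of k x] assms(1) x by auto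
    show "\<bar>vacancy_iter k n x - vacancy k x\<bar> \<le> (real k * x) ^ n / fact n" by (rule Suc.IH[OF x1])
  qed
  moreover have "integral {0..s} (\<lambda>x. vacancy k x ^ k) = 1 - vacancy k s"
    using integral_vacancy_power(1)[of k s] assms(1) Suc.prems by (auto intro: integral_unique)
  ultimately show ?case by (simp add: power_mult_distrib mult_ac abs_minus_commute)
qed

lemma tendsto_integral_vacancy_iter_power:
  assumes "k \<ge> 1" "t \<in> {0..1}"
  shows "(\<lambda>n. integral {0..t} (\<lambda>x. vacancy_iter k n x ^ m)) \<longlonglongrightarrow> integral {0..t} (\<lambda>x. vacancy k x ^ m)"
proof -
  have bound: "\<bar>integral {0..t} (\<lambda>x. vacancy_iter k n x ^ m) - integral {0..t} (\<lambda>x. vacancy k x ^ m)\<bar>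
      \<le> real m * (real k ^ n / fact n * t)" for n
  proof (rule integral_power_diff_le)
    show "continuous_on {0..t} (vacancy_iter k n)"
      using assms(2) by (intro continuous_on_subset[OF continuous_vacancy_iter]) auto
    show "continuous_on {0..t} (vacancy k)" using assms(1) by (rule continuous_vacancy)
    show "((\<lambda>x. real k ^ n / fact n) has_integral real k ^ n / fact n * t) {0..t}"
      using has_integral_const_real[of "real k ^ n / fact n" 0 t] assms(2) by (simp add: mult.commute)
    fix x assume x: "x \<in> {0..t}"
    then have x1: "x \<in> {0..1}" using assms(2) by auto
    show "\<bar>vacancy_iter k n x\<bar> \<le> 1" using vacancy_iter_bounds[OF x1] by auto
    show "\<bar>vacancy k x\<bar> \<le> 1" using vacancy_bounds[of k x] assms(1) x by auto
    have "(real k * x) ^ n \<le> real k ^ n"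
      using x1 by (intro power_mono) (auto intro: mult_left_le)
    then show "\<bar>vacancy_iter k n x - vacancy k x\<bar> \<le> real k ^ n / fact n"
      using vacancy_iter_error[OF assms(1) x1, of n] by (smt (verit) divide_right_mono fact_ge_zero)
  qed
  have "(\<lambda>n. real k ^ n / fact n) \<longlonglongrightarrow> 0"
    using summable_LIMSEQ_zero[OF summable_exp[of "real k"]] by (simp add: field_simps)
  then have "(\<lambda>n. real m * (real k ^ n / fact n * t)) \<longlonglongrightarrow> real m * (0 * t)"
    by (intro tendsto_intros)
  then have lim0: "(\<lambda>n. real m * (real k ^ n / fact n * t)) \<longlonglongrightarrow> 0"
    by simp
  have "(\<lambda>n. integral {0..t} (\<lambda>x. vacancy_iter k n x ^ m) - integral {0..t} (\<lambda>x. vacancy k x ^ m)) \<longlonglongrightarrow> 0"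
    by (rule Lim_null_comparison[OF always_eventually lim0]) (simp only: real_norm_def bound simp_thms)
  then show ?thesis by (rule LIM_zero_cancel)
qed

section \<open>A uniform time preceding independent times\<close>

text \<open>
  Fubini: conditionally on \<open>Y v = x\<close> the independent variables \<open>Y u\<close> are all at least \<open>x\<close> with
  probability \<open>G x\<close>, and \<open>Y v\<close> has density \<open>1\<close> on the unit interval.
\<close>

lemma (in prob_space) prob_uniform_le_independent:
  fixes Y :: "'i \<Rightarrow> 'a \<Rightarrow> real"
  assumes ind: "indep_vars (\<lambda>_. borel) Y (insert v U)" and U: "finite U" "U \<noteq> {}" "v \<notin> U"
    and unif: "distr M borel (Y v) = uniform_measure lborel {0<..<1}"
    and t: "t \<in> {0..1}"
    and G: "continuous_on {0..1} G"
    and tail: "\<And>x. x \<in> {0..1} \<Longrightarrow> (\<Prod>u\<in>U. prob {\<omega> \<in> space M. x \<le> Y u \<omega>}) = G x"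
  shows "prob {\<omega> \<in> space M. Y v \<omega> \<le> t \<and> (\<forall>u\<in>U. Y v \<omega> \<le> Y u \<omega>)} = integral {0..t} G"
proof -
  let ?N = "PiM U (\<lambda>_. borel) :: ('i \<Rightarrow> real) measure"
  let ?Z = "\<lambda>\<omega>. restrict (\<lambda>u. Y u \<omega>) U"
  let ?X = "{(x, y). x \<le> t \<and> (\<forall>u\<in>U. x \<le> y u)} \<inter> space (borel \<Otimes>\<^sub>M ?N) :: (real \<times> ('i \<Rightarrow> real)) set"
  have Yrv: "random_variable borel (Y i)" if "i \<in> insert v U" for i
    using ind that by (auto simp: indep_vars_def)
  let ?Nv = "PiM {v} (\<lambda>_. borel) :: ('i \<Rightarrow> real) measure"
  \<comment> \<open>Independence of two random variables is a statement about variables of one common type. So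
      \<open>Y v\<close> first enters as the one-component vector \<open>?W\<close>, and the integral over its
      law is carried back to the law of \<open>Y v\<close> afterwards.\<close>
  let ?W = "\<lambda>\<omega>. restrict (\<lambda>i. Y i \<omega>) {v}"
  let ?X' = "{(a, y). a v \<le> t \<and> (\<forall>u\<in>U. a v \<le> y u)} \<inter> space (?Nv \<Otimes>\<^sub>M ?N)"
  have "indep_var ?Nv ?W ?N ?Z"
    using U by (intro indep_var_restrict[OF ind]) auto
  then have W: "random_variable ?Nv ?W" and Z: "random_variable ?N ?Z"
    and joint: "distr M ?Nv ?W \<Otimes>\<^sub>M distr M ?N ?Z = distr M (?Nv \<Otimes>\<^sub>M ?N) (\<lambda>\<omega>. (?W \<omega>, ?Z \<omega>))"
    by (auto simp: indep_var_distribution_eq)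
  interpret Z: prob_space "distr M ?N ?Z" using Z by (rule prob_space_distr)
  have X: "?X \<in> sets (borel \<Otimes>\<^sub>M ?N)"
  proof -
    have "Measurable.pred (borel \<Otimes>\<^sub>M ?N) (\<lambda>p. fst p \<le> t \<and> (\<forall>u\<in>U. fst p \<le> snd p u))"
      using U(1) by measurable
    then show ?thesis by (simp add: pred_def case_prod_unfold Int_def conj_commute)
  qed
  have [measurable]: "(\<lambda>p. fst p v) \<in> borel_measurable (?Nv \<Otimes>\<^sub>M ?N)"
    using measurable_component_singleton[of v "{v}" "\<lambda>_. borel"] by (intro measurable_compose[OF measurable_fst]) auto
  have X': "?X' \<in> sets (?Nv \<Otimes>\<^sub>M ?N)"
  proof -
    have "Measurable.pred (?Nv \<Otimes>\<^sub>M ?N) (\<lambda>p. fst p v \<le> t \<and> (\<forall>u\<in>U. fst p v \<le> snd p u))"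
      using U(1) by measurable
    then show ?thesis by (simp add: pred_def case_prod_unfold Int_def conj_commute)
  qed
  have WZ: "random_variable (?Nv \<Otimes>\<^sub>M ?N) (\<lambda>\<omega>. (?W \<omega>, ?Z \<omega>))"
    using W Z by (rule measurable_Pair)
  have slice: "emeasure (distr M ?N ?Z) (Pair x -` ?X) = ennreal (G x) * indicator {..t} x"
    if x: "x \<in> {0<..<1}" for x
  proof (cases "x \<le> t")
    case True
    have "Pair x -` ?X \<in> sets ?N" using X by (rule sets_Pair1)
    then have "emeasure (distr M ?N ?Z) (Pair x -` ?X) = emeasure M (?Z -` (Pair x -` ?X) \<inter> space M)"
      using Z by (intro emeasure_distr) auto
    also have "?Z -` (Pair x -` ?X) \<inter> space M = (\<Inter>u\<in>U. Y u -` {x..} \<inter> space M)"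
      using True U measurable_space[OF Z] by (auto simp: space_pair_measure)
    also have "emeasure M \<dots> = ennreal (\<Prod>u\<in>U. prob (Y u -` {x..} \<inter> space M))"
      using U by (subst indep_varsD[OF ind, symmetric]) (auto simp: emeasure_eq_measure)
    also have "(\<Prod>u\<in>U. prob (Y u -` {x..} \<inter> space M)) = G x"
      using tail[of x] x by (simp add: vimage_def Int_def conj_commute)
    finally have "emeasure (distr M ?N ?Z) (Pair x -` ?X) = ennreal (G x)" .
    moreover have "indicator {..t} x = (1 :: ennreal)" using True by simp
    ultimately show ?thesis by (simp only: mult_1_right)
  next
    case False
    then have "Pair x -` ?X = {}" by auto
    with False show ?thesis by simp
  qed
  have Gnn: "0 \<le> G x" if "x \<in> {0..1}" for x
    using tail[OF that] by (metis measure_nonneg prod_nonneg)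
  have "G integrable_on {0..t}"
    using t by (intro integrable_continuous_real continuous_on_subset[OF G]) auto
  then have Gint: "(G has_integral integral {0..t} G) {0..t}" by blast
  have hm: "(\<lambda>x. emeasure (distr M ?N ?Z) (Pair x -` ?X)) \<in> borel_measurable borel"
  proof -
    have "sets (borel \<Otimes>\<^sub>M distr M ?N ?Z) = sets (borel \<Otimes>\<^sub>M ?N)"
      by (intro sets_pair_measure_cong) auto
    with X show ?thesis by (intro Z.measurable_emeasure_Pair) simp
  qed
  have "{\<omega> \<in> space M. Y v \<omega> \<le> t \<and> (\<forall>u\<in>U. Y v \<omega> \<le> Y u \<omega>)} = (\<lambda>\<omega>. (?W \<omega>, ?Z \<omega>)) -` ?X' \<inter> space M"
    using measurable_space[OF WZ] by auto
  then have "emeasure M {\<omega> \<in> space M. Y v \<omega> \<le> t \<and> (\<forall>u\<in>U. Y v \<omega> \<le> Y u \<omega>)}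
      = emeasure (distr M ?Nv ?W \<Otimes>\<^sub>M distr M ?N ?Z) ?X'"
    using X' WZ by (simp add: joint emeasure_distr)
  also have "\<dots> = (\<integral>\<^sup>+a. emeasure (distr M ?N ?Z) (Pair a -` ?X') \<partial>distr M ?Nv ?W)"
  proof (rule Z.emeasure_pair_measure_alt)
    have "sets (distr M ?Nv ?W \<Otimes>\<^sub>M distr M ?N ?Z) = sets (?Nv \<Otimes>\<^sub>M ?N)"
      by (intro sets_pair_measure_cong) auto
    with X' show "?X' \<in> sets (distr M ?Nv ?W \<Otimes>\<^sub>M distr M ?N ?Z)" by simp
  qed
  also have "\<dots> = (\<integral>\<^sup>+\<omega>. emeasure (distr M ?N ?Z) (Pair (?W \<omega>) -` ?X') \<partial>M)"
  proof (rule nn_integral_distr[OF W])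
    have "sets (?Nv \<Otimes>\<^sub>M distr M ?N ?Z) = sets (?Nv \<Otimes>\<^sub>M ?N)"
      by (intro sets_pair_measure_cong) auto
    with X' have "(\<lambda>a. emeasure (distr M ?N ?Z) (Pair a -` ?X')) \<in> borel_measurable ?Nv"
      by (intro Z.measurable_emeasure_Pair) simp
    then show "(\<lambda>a. emeasure (distr M ?N ?Z) (Pair a -` ?X')) \<in> borel_measurable (distr M ?Nv ?W)"
      by simp
  qed
  also have "\<dots> = (\<integral>\<^sup>+\<omega>. emeasure (distr M ?N ?Z) (Pair (Y v \<omega>) -` ?X) \<partial>M)"
  proof (rule nn_integral_cong)
    fix \<omega> assume "\<omega> \<in> space M"
    then have "Pair (?W \<omega>) -` ?X' = Pair (Y v \<omega>) -` ?X"
      using measurable_space[OF W] by (auto simp: space_pair_measure)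
    then show "emeasure (distr M ?N ?Z) (Pair (?W \<omega>) -` ?X') = emeasure (distr M ?N ?Z) (Pair (Y v \<omega>) -` ?X)"
      by simp
  qed
  also have "\<dots> = (\<integral>\<^sup>+x. emeasure (distr M ?N ?Z) (Pair x -` ?X) \<partial>distr M borel (Y v))"
    using hm Yrv[of v] by (subst nn_integral_distr) auto
  also have "\<dots> = (\<integral>\<^sup>+x. emeasure (distr M ?N ?Z) (Pair x -` ?X) * indicator {0<..<1} x \<partial>lborel)"
    unfolding unif using hm by (subst nn_integral_uniform_measure) (auto simp: divide_ennreal_def)
  also have "\<dots> = (\<integral>\<^sup>+x. ennreal (G x) * indicator {0..t} x \<partial>lborel)"
  proof (rule nn_integral_cong_AE)
    show "AE x in lborel. emeasure (distr M ?N ?Z) (Pair x -` ?X) * indicator {0<..<1} x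
        = ennreal (G x) * indicator {0..t} x"
      using AE_lborel_singleton[of 0] AE_lborel_singleton[of 1]
    proof eventually_elim
      case (elim x)
      show ?case
      proof (cases "x \<in> {0<..<1}")
        case True
        have "emeasure (distr M ?N ?Z) (Pair x -` ?X) * indicator {0<..<1} x
            = ennreal (G x) * indicator {..t} x * indicator {0<..<1} x"
          by (simp only: slice[OF True])
        also have "\<dots> = ennreal (G x) * indicator {0..t} x"
          using True by (auto simp: indicator_def)
        finally show ?thesis .
      next
        case False
        then show ?thesis using elim t by (auto simp: indicator_def)
      qed
    qed
  qed
  also have "\<dots> = (\<integral>\<^sup>+x. ennreal (if x \<in> {0..t} then G x else 0) \<partial>lborel)"
    by (intro nn_integral_cong) (auto simp: indicator_def)
  also have "\<dots> = ennreal (integral {0..t} G)"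
  proof -
    have *: "continuous_on {0..t} G" using t by (intro continuous_on_subset[OF G]) auto
    show ?thesis
    proof (rule nn_integral_has_integral_lborel)
      show "(\<lambda>x. if x \<in> {0..t} then G x else 0) \<in> borel_measurable borel"
        using * by (intro borel_measurable_continuous_on_if) auto
      show "0 \<le> (if x \<in> {0..t} then G x else 0)" for x using Gnn t by auto
      show "((\<lambda>x. if x \<in> {0..t} then G x else 0) has_integral integral {0..t} G) UNIV"
        using Gint by (simp only: has_integral_restrict_UNIV)
    qed
  qed
  finally have "ennreal (prob {\<omega> \<in> space M. Y v \<omega> \<le> t \<and> (\<forall>u\<in>U. Y v \<omega> \<le> Y u \<omega>)})
      = ennreal (integral {0..t} G)"
    by (simp only: emeasure_eq_measure)
  moreover have "0 \<le> integral {0..t} G"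
    using t by (intro integral_nonneg \<open>G integrable_on {0..t}\<close> Gnn) auto
  ultimately show ?thesis
    by (simp only: ennreal_inj measure_nonneg)
qed

section \<open>The probability of bounded-depth acceptance\<close>

lemma iid_uniform_rv:
  assumes "iid_uniform M V \<tau>" "v \<in> V"
  shows "\<tau> v \<in> borel_measurable M"
proof -
  interpret prob_space M using assms(1) by (simp add: iid_uniform_def)
  have "indep_vars (\<lambda>_. borel) \<tau> V" using assms(1) by (simp add: iid_uniform_def)
  then show ?thesis using assms(2) by (auto simp: indep_vars_def)
qed

lemma iid_uniform_no_atom:
  assumes "iid_uniform M V \<tau>" "v \<in> V"
  shows "AE \<omega> in M. \<tau> v \<omega> \<noteq> x"
proof -
  have d: "distr M borel (\<tau> v) = uniform_measure lborel {0<..<1}"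
    using assms by (auto simp: iid_uniform_def)
  have "AE y in uniform_measure lborel {0<..<1}. y \<noteq> x"
    using AE_lborel_singleton[of x] by (intro AE_uniform_measureI) auto
  then have "AE y in distr M borel (\<tau> v). y \<noteq> x" unfolding d .
  then show ?thesis
    using iid_uniform_rv[OF assms] by (subst (asm) AE_distr_iff) auto
qed

lemma measurable_acc_upto_iid:
  assumes "iid_uniform M V \<tau>" "simple_graph V E" "\<And>w. finite {u. E w u}" "v \<in> V"
  shows "Measurable.pred M (\<lambda>\<omega>. acc_upto E n P (\<lambda>u. \<tau> u \<omega>) v)"
proof -
  have "explored E n P v \<subseteq> V"
    using assms(2,4) by (intro explored_subset) (auto simp: simple_graph_def)
  then show ?thesis
    using assms(1,3) by (intro measurable_acc_upto) (auto intro: iid_uniform_rv)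
qed

text \<open>
  The random variable attached to a neighbour \<open>u\<close> is the time at which \<open>u\<close> becomes occupied
  according to the depth-\<open>n\<close> recursion. It is a function of the arrival times in the branch of
  \<open>u\<close>, and these branches are disjoint from each other and from \<open>{v}\<close>. The value \<open>2\<close>
  stands for infinity: it exceeds all times in the unit interval.
\<close>

lemma indep_branch_times:
  fixes V :: "'a set" and M :: "'w measure"
  assumes iid: "iid_uniform M V \<tau>"
    and G: "simple_graph V E" "\<nexists>xs. graph_cycle E xs" "\<And>w. finite {u. E w u}"
    and v: "v \<in> V" and U: "U \<subseteq> {u. E v u}"
  shows "prob_space.indep_vars M (\<lambda>_. borel)
    (\<lambda>u \<omega>. if u = v then \<tau> v \<omega> else if acc_upto E n {v} (\<lambda>w. \<tau> w \<omega>) u then \<tau> u \<omega> else 2) (insert v U)"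
proof -
  interpret prob_space M using iid by (simp add: iid_uniform_def)
  have ind: "indep_vars (\<lambda>_. borel) \<tau> V" using iid by (simp add: iid_uniform_def)
  define K where "K u = (if u = v then {v} else branch E {v} u)" for u
  define Y where "Y u f = (if u = v then f v else if acc_upto E n {v} f u then f u else 2)"
    for u and f :: "'a \<Rightarrow> real"
  have UV: "u \<in> V" "u \<noteq> v" "E v u" "E u v" if "u \<in> U" for u
    using that U G(1) by (auto simp: simple_graph_def)
  have expl: "explored E n {v} u \<subseteq> K u" if "u \<in> U" for u
    using explored_subset_branch[OF G(1,2), of "{v}" u n] UV[OF that] by (auto simp: K_def)
  have vK: "v \<notin> K u" if "u \<in> U" for u
    using branch_avoids[of v E "{v}" u] UV[OF that] by (auto simp: K_def)
  have "disjoint_family_on K (insert v U)"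
    unfolding disjoint_family_on_def
  proof (intro ballI impI)
    fix a b assume ab: "a \<in> insert v U" "b \<in> insert v U" "a \<noteq> b"
    show "K a \<inter> K b = {}"
    proof (cases "a = v \<or> b = v")
      case True
      then show ?thesis using ab vK by (auto simp: K_def[of v])
    next
      case False
      then show ?thesis using ab U branches_disjoint[OF G(1,2), of v a b] by (auto simp: K_def)
    qed
  qed
  moreover have "K u \<subseteq> V" if "u \<in> insert v U" for u
    using that v UV branch_subset_vertices[OF G(1), of u "{v}"] by (auto simp: K_def)
  ultimately have "indep_vars (\<lambda>u. PiM (K u) (\<lambda>_. borel)) (\<lambda>u \<omega>. restrict (\<lambda>i. \<tau> i \<omega>) (K u)) (insert v U)"
    by (intro indep_vars_restrict[OF ind])
  then have "indep_vars (\<lambda>_. borel) (\<lambda>u \<omega>. Y u (restrict (\<lambda>i. \<tau> i \<omega>) (K u))) (insert v U)"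
  proof (rule indep_vars_compose2)
    fix u assume u: "u \<in> insert v U"
    show "Y u \<in> borel_measurable (PiM (K u) (\<lambda>_. borel))"
    proof (cases "u = v")
      case True
      have "(\<lambda>f. f v) \<in> borel_measurable (PiM (K v) (\<lambda>_. borel :: real measure))"
        by (rule measurable_component_singleton) (simp add: K_def)
      then show ?thesis using True by (simp add: Y_def[abs_def])
    next
      case False
      then have uU: "u \<in> U" using u by simp
      have comp: "(\<lambda>f. f w) \<in> borel_measurable (PiM (K u) (\<lambda>_. borel :: real measure))" if "w \<in> K u" for w
        using that by (rule measurable_component_singleton)
      have [measurable]: "Measurable.pred (PiM (K u) (\<lambda>_. borel)) (\<lambda>f. acc_upto E n {v} f u)"
        using expl[OF uU] comp by (intro measurable_acc_upto G(3)) auto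
      have [measurable]: "(\<lambda>f. f u) \<in> borel_measurable (PiM (K u) (\<lambda>_. borel :: real measure))"
        using expl[OF uU] by (intro comp) auto
      show ?thesis using False unfolding Y_def[abs_def] by simp
    qed
  qed
  moreover have "Y u (restrict (\<lambda>i. \<tau> i \<omega>) (K u)) =
      (if u = v then \<tau> v \<omega> else if acc_upto E n {v} (\<lambda>w. \<tau> w \<omega>) u then \<tau> u \<omega> else 2)"
    if "u \<in> insert v U" for u \<omega>
  proof (cases "u = v")
    case True
    then show ?thesis by (simp add: Y_def K_def)
  next
    case False
    then have uU: "u \<in> U" using that by simp
    have "acc_upto E n {v} (restrict (\<lambda>i. \<tau> i \<omega>) (K u)) u = acc_upto E n {v} (\<lambda>w. \<tau> w \<omega>) u"
      using expl[OF uU] by (intro acc_upto_cong) auto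
    moreover have "u \<in> K u" using expl[OF uU] by auto
    ultimately show ?thesis using False by (simp add: Y_def)
  qed
  ultimately show ?thesis
    by (subst (asm) indep_vars_cong[OF refl _ refl]) (rule ext, assumption, assumption)
qed

text \<open>
  Up to time \<open>1\<close>, the vertex \<open>v\<close> is accepted exactly if it arrives no later than the occupation
  times of the neighbours outside \<open>P\<close>, which are independent with tail \<open>g\<close>.
\<close>

lemma prob_acc_upto_Suc:
  assumes iid: "iid_uniform M V \<tau>"
    and G: "simple_graph V E" "\<nexists>xs. graph_cycle E xs" "\<And>w. finite {u. E w u}"
    and v: "v \<in> V" and U: "{u. E v u} - P \<noteq> {}" and t: "t \<in> {0..1}"
    and g: "continuous_on {0..1} g"
    and child: "\<And>u x. u \<in> {u. E v u} - P \<Longrightarrow> x \<in> {0..1} \<Longrightarrow>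
      \<P>(\<omega> in M. \<tau> u \<omega> \<le> x \<and> acc_upto E n {v} (\<lambda>w. \<tau> w \<omega>) u) = 1 - g x"
  shows "\<P>(\<omega> in M. \<tau> v \<omega> \<le> t \<and> acc_upto E (Suc n) P (\<lambda>w. \<tau> w \<omega>) v)
    = integral {0..t} (\<lambda>x. g x ^ card ({u. E v u} - P))"
proof -
  interpret prob_space M using iid by (simp add: iid_uniform_def)
  define U where "U = {u. E v u} - P"
  define Y where "Y u \<omega> = (if u = v then \<tau> v \<omega> else if acc_upto E n {v} (\<lambda>w. \<tau> w \<omega>) u then \<tau> u \<omega> else 2)"
    for u \<omega>
  have UV: "u \<in> V" "u \<noteq> v" if "u \<in> U" for u
    using that G(1) by (auto simp: simple_graph_def U_def)
  have meas: "random_variable borel (\<tau> u)" "Measurable.pred M (\<lambda>\<omega>. acc_upto E n {v} (\<lambda>w. \<tau> w \<omega>) u)"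
    if "u \<in> V" for u
    using iid_uniform_rv[OF iid that] measurable_acc_upto_iid[OF iid G(1,3) that] by auto
  have "prob {\<omega> \<in> space M. Y v \<omega> \<le> t \<and> (\<forall>u\<in>U. Y v \<omega> \<le> Y u \<omega>)} = integral {0..t} (\<lambda>x. g x ^ card U)"
  proof (rule prob_uniform_le_independent)
    show "indep_vars (\<lambda>_. borel) Y (insert v U)"
      unfolding Y_def[abs_def] by (rule indep_branch_times[OF iid G v]) (auto simp: U_def)
    show "finite U" "U \<noteq> {}" using G(3) U by (auto simp: U_def)
    show "v \<notin> U" using UV by blast
    show "distr M borel (Y v) = uniform_measure lborel {0<..<1}"
      using iid v by (simp add: Y_def[abs_def] iid_uniform_def)
    show "continuous_on {0..1} (\<lambda>x. g x ^ card U)" using g by (intro continuous_intros)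
    fix x :: real assume x: "x \<in> {0..1}"
    \<comment> \<open>Vacancy just before \<open>x\<close> and vacancy at \<open>x\<close> differ by the null event that \<open>u\<close> arrives at \<open>x\<close>.\<close>
    have "prob {\<omega> \<in> space M. x \<le> Y u \<omega>} = g x" if u: "u \<in> U" for u
    proof -
      note [measurable] = meas[OF UV(1)[OF u]]
      have "{\<omega> \<in> space M. x \<le> Y u \<omega>} =
          space M - {\<omega> \<in> space M. \<tau> u \<omega> < x \<and> acc_upto E n {v} (\<lambda>w. \<tau> w \<omega>) u}"
        using UV[OF u] x by (auto simp: Y_def not_less)
      then have "prob {\<omega> \<in> space M. x \<le> Y u \<omega>} =
          1 - prob {\<omega> \<in> space M. \<tau> u \<omega> < x \<and> acc_upto E n {v} (\<lambda>w. \<tau> w \<omega>) u}"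
        by (simp add: prob_compl)
      also have "prob {\<omega> \<in> space M. \<tau> u \<omega> < x \<and> acc_upto E n {v} (\<lambda>w. \<tau> w \<omega>) u} =
          prob {\<omega> \<in> space M. \<tau> u \<omega> \<le> x \<and> acc_upto E n {v} (\<lambda>w. \<tau> w \<omega>) u}"
      proof (rule prob_eq_AE)
        show "AE \<omega> in M. (\<tau> u \<omega> < x \<and> acc_upto E n {v} (\<lambda>w. \<tau> w \<omega>) u) \<longleftrightarrow>
            (\<tau> u \<omega> \<le> x \<and> acc_upto E n {v} (\<lambda>w. \<tau> w \<omega>) u)"
          using iid_uniform_no_atom[OF iid UV(1)[OF u], of x] by eventually_elim auto
      qed measurable
      also have "\<dots> = 1 - g x" using child[of u x] u x by (simp add: U_def)
      finally show ?thesis by simp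
    qed
    then show "(\<Prod>u\<in>U. prob {\<omega> \<in> space M. x \<le> Y u \<omega>}) = g x ^ card U" by simp
  qed (rule t)
  also have "{\<omega> \<in> space M. Y v \<omega> \<le> t \<and> (\<forall>u\<in>U. Y v \<omega> \<le> Y u \<omega>)} =
      {\<omega> \<in> space M. \<tau> v \<omega> \<le> t \<and> acc_upto E (Suc n) P (\<lambda>w. \<tau> w \<omega>) v}"
    using UV t by (force simp: Y_def U_def)
  finally show ?thesis by (simp add: U_def)
qed

text \<open>
  In the induction the branch of each child \<open>u\<close> again has \<open>k\<close> children at its root, because the
  degree of \<open>u\<close> is \<open>k + 1\<close> and its neighbour \<open>v\<close> is excluded. Restricting the degree condition to
  the branch without its root lets \<open>v\<close> itself have any positive number of children, which covers
  the root of \<open>T\<^sub>k\<^sup>*\<close> and the vertices of \<open>T\<^sub>k\<close> alike.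
\<close>

lemma prob_acc_upto:
  assumes iid: "iid_uniform M V \<tau>"
    and G: "simple_graph V E" "\<nexists>xs. graph_cycle E xs" "\<And>w. finite {u. E w u}"
    and k: "1 \<le> k" and v: "v \<in> V" and P: "P \<subseteq> {u. E v u}" and U: "{u. E v u} - P \<noteq> {}"
    and t: "t \<in> {0..1}"
    and deg: "\<And>w. w \<in> branch E P v - {v} \<Longrightarrow> vertex_degree E w = k + 1"
  shows "\<P>(\<omega> in M. \<tau> v \<omega> \<le> t \<and> acc_upto E (Suc n) P (\<lambda>w. \<tau> w \<omega>) v)
    = integral {0..t} (\<lambda>x. vacancy_iter k n x ^ card ({u. E v u} - P))"
  using v P U t deg
proof (induction n arbitrary: v P t)
  case 0
  show ?case
    using 0 by (intro prob_acc_upto_Suc[OF iid G] continuous_vacancy_iter) auto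
next
  case (Suc n)
  show ?case
  proof (rule prob_acc_upto_Suc[OF iid G Suc.prems(1,3,4) continuous_vacancy_iter])
    fix u x assume u: "u \<in> {u. E v u} - P" and x: "x \<in> {0..1 :: real}"
    have uv: "u \<in> V" "u \<noteq> v" "E u v" "E v u" using u G(1) by (auto simp: simple_graph_def)
    have sub: "branch E {v} u \<subseteq> branch E P v"
      using subbranch_subset[OF G(1,2) Suc.prems(2)] u by auto
    have "v \<notin> branch E {v} u" using branch_avoids[of v E "{v}" u] uv by auto
    then have deg': "vertex_degree E w = k + 1" if "w \<in> branch E {v} u" for w
      using that sub by (intro Suc.prems(5)) auto
    have card: "card ({w. E u w} - {v}) = k"
      using deg'[OF self_in_branch] uv(3) G(3)[of u] by (simp add: vertex_degree_def)
    then have "{w. E u w} - {v} \<noteq> {}" using k by (metis card.empty not_one_le_zero)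
    then have "\<P>(\<omega> in M. \<tau> u \<omega> \<le> x \<and> acc_upto E (Suc n) {v} (\<lambda>w. \<tau> w \<omega>) u)
        = integral {0..x} (\<lambda>x. vacancy_iter k n x ^ card ({w. E u w} - {v}))"
      using uv x deg' by (intro Suc.IH) auto
    then show "\<P>(\<omega> in M. \<tau> u \<omega> \<le> x \<and> acc_upto E (Suc n) {v} (\<lambda>w. \<tau> w \<omega>) u) = 1 - vacancy_iter k (Suc n) x"
      by (simp add: card)
  qed
qed

section \<open>The vacancy probability in the infinite tree\<close>

text \<open>
  The lower bounds for the two disjoint events that the state settles at \<open>0\<close> and at \<open>1\<close> add up
  to \<open>1\<close>. So both are sharp, and the state settles almost surely.
\<close>

lemma prob_rsa_eq_0:
  assumes iid: "iid_uniform M V \<tau>" and T: "infinite_tree V E"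
    and fin: "\<And>w. finite {u. E w u}"
    and k: "1 \<le> k" and v: "v \<in> V" and m: "vertex_degree E v = m" "1 \<le> m" and t: "t \<in> {0..1}"
    and deg: "\<And>w. w \<in> V - {v} \<Longrightarrow> vertex_degree E w = k + 1"
  shows "\<P>(\<omega> in M. rsa E V (\<lambda>u. \<tau> u \<omega>) t v = 0) = 1 - integral {0..t} (\<lambda>x. vacancy k x ^ m)"
proof -
  interpret prob_space M using iid by (simp add: iid_uniform_def)
  have G: "simple_graph V E" "\<nexists>xs. graph_cycle E xs" and conn: "graph_connected V E"
    using T by (auto simp: infinite_tree_def)
  have cV: "countable V" using conn fin by (rule countable_connected_locally_finite)
  define I where "I = integral {0..t} (\<lambda>x. vacancy k x ^ m)"
  define p where "p n = prob {\<omega> \<in> space M. \<tau> v \<omega> \<le> t \<and> acc_upto E (Suc n) {} (\<lambda>w. \<tau> w \<omega>) v}" for n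
  let ?S = "\<lambda>x. {\<omega> \<in> space M. settles E V (\<lambda>u. \<tau> u \<omega>) t v x}"
  have p: "p n = integral {0..t} (\<lambda>x. vacancy_iter k n x ^ m)" for n
  proof -
    have "{u. E v u} \<noteq> {}" using m unfolding vertex_degree_def by (metis card.empty not_one_le_zero)
    then have "p n = integral {0..t} (\<lambda>x. vacancy_iter k n x ^ card ({u. E v u} - {}))"
      unfolding p_def using branch_subset_vertices[OF G(1) v, of "{}"]
      by (intro prob_acc_upto[OF iid G fin k v _ _ t] deg) auto
    then show ?thesis using m by (simp add: vertex_degree_def)
  qed
  have lim: "p \<longlonglongrightarrow> I"
    unfolding p I_def using tendsto_integral_vacancy_iter_power[OF k t] by simp
  have expl: "explored E n {} v \<subseteq> V" for n
    using v G(1) by (intro explored_subset) (auto simp: simple_graph_def)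
  have [measurable]: "Measurable.pred M (\<lambda>\<omega>. settles E V (\<lambda>u. \<tau> u \<omega>) t v x)" for x
    using iid_uniform_rv[OF iid] by (intro measurable_settles[OF cV _ v]) auto
  have [measurable]: "Measurable.pred M (\<lambda>\<omega>. acc_upto E n {} (\<lambda>u. \<tau> u \<omega>) v)" for n
    using measurable_acc_upto_iid[OF iid G(1) fin v] .
  have [measurable]: "random_variable borel (\<tau> v)" using iid_uniform_rv[OF iid v] .
  have S1: "I \<le> prob (?S 1)"
  proof (rule LIMSEQ_le_const2)
    show "(\<lambda>n. p (2 * n + 1)) \<longlonglongrightarrow> I"
      using LIMSEQ_subseq_LIMSEQ[OF lim, of "\<lambda>n. 2 * n + 1"] by (simp add: strict_mono_def comp_def)
    have "p (2 * n + 1) \<le> prob (?S 1)" for n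
      unfolding p_def
      using settles_if_acc_upto(1)[OF fin expl[of "Suc (2 * n + 1)"]]
      by (intro finite_measure_mono) (auto simp del: acc_upto.simps)
    then show "\<exists>N. \<forall>n\<ge>N. p (2 * n + 1) \<le> prob (?S 1)" by blast
  qed
  have S0: "1 - I \<le> prob (?S 0)"
  proof (rule LIMSEQ_le_const2)
    have "(\<lambda>n. p (2 * n)) \<longlonglongrightarrow> I"
      using LIMSEQ_subseq_LIMSEQ[OF lim, of "\<lambda>n. 2 * n"] by (simp add: strict_mono_def comp_def)
    then show "(\<lambda>n. 1 - p (2 * n)) \<longlonglongrightarrow> 1 - I" by (intro tendsto_intros)
    have "1 - p (2 * n) \<le> prob (?S 0)" for n
    proof -
      let ?A = "{\<omega> \<in> space M. \<tau> v \<omega> \<le> t \<and> acc_upto E (Suc (2 * n)) {} (\<lambda>w. \<tau> w \<omega>) v}"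
      have "1 - p (2 * n) = prob (space M - ?A)"
        unfolding p_def by (rule prob_compl[symmetric]) measurable
      also have "\<dots> \<le> prob (?S 0)"
      proof (rule finite_measure_mono)
        have "settles E V (\<lambda>u. \<tau> u \<omega>) t v 0"
          if "\<not> (\<tau> v \<omega> \<le> t \<and> acc_upto E (Suc (2 * n)) {} (\<lambda>w. \<tau> w \<omega>) v)" for \<omega>
          using that by (intro settles_if_acc_upto(2)[OF fin expl[of "Suc (2 * n)"]]) auto
        then show "space M - ?A \<subseteq> ?S 0" by blast
      qed measurable
      finally show ?thesis .
    qed
    then show "\<exists>N. \<forall>n\<ge>N. 1 - p (2 * n) \<le> prob (?S 0)" by blast
  qed
  have disj: "?S 0 \<inter> ?S 1 = {}"
  proof -
    have "\<not> (settles E V f t v 0 \<and> settles E V f t v 1)" for f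
      using settles_unique by (metis zero_neq_one)
    then show ?thesis by blast
  qed
  have ev: "?S x \<in> events" for x by measurable
  have Un: "prob (?S 0 \<union> ?S 1) = prob (?S 0) + prob (?S 1)"
    by (rule finite_measure_Union[OF ev ev disj])
  moreover have "prob (?S 0 \<union> ?S 1) \<le> 1" by (rule prob_le_1)
  ultimately have eq: "prob (?S 0) = 1 - I" "prob (?S 1) = I" using S0 S1 by linarith+
  then have "prob (?S 0 \<union> ?S 1) = 1" using Un by linarith
  then have "AE \<omega> in M. \<omega> \<in> ?S 0 \<union> ?S 1" by (rule AE_prob_1)
  then have "AE \<omega> in M. settles E V (\<lambda>u. \<tau> u \<omega>) t v 0 \<or> settles E V (\<lambda>u. \<tau> u \<omega>) t v 1"
    by eventually_elim blast
  then have ae: "AE \<omega> in M. rsa E V (\<lambda>u. \<tau> u \<omega>) t v = 0 \<longleftrightarrow> settles E V (\<lambda>u. \<tau> u \<omega>) t v 0"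
    by eventually_elim (metis rsa_eqI[OF cV] zero_neq_one)
  \<comment> \<open>On the null event that the state does not settle, \<open>rsa\<close> is one fixed unspecified
    number, namely \<open>THE x. False\<close>. Whatever it is, the event \<open>rsa = 0\<close> is measurable.\<close>
  have meas: "{\<omega> \<in> space M. rsa E V (\<lambda>u. \<tau> u \<omega>) t v = 0} \<in> events"
  proof -
    have "rsa E V f t v = 0 \<longleftrightarrow> settles E V f t v 0 \<or>
        \<not> settles E V f t v 0 \<and> \<not> settles E V f t v 1 \<and> (THE x :: nat. False) = 0" for f
    proof (cases "\<exists>x. settles E V f t v x")
      case True
      then show ?thesis using rsa_eqI[OF cV] settles_0_or_1 by (metis zero_neq_one)
    next
      case False
      then show ?thesis by (simp add: rsa_alt[OF cV])
    qed
    then show ?thesis by simp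
  qed
  have "prob {\<omega> \<in> space M. rsa E V (\<lambda>u. \<tau> u \<omega>) t v = 0} = prob (?S 0)"
    using ae meas by (intro finite_measure_eq_AE) auto
  then show ?thesis using eq by (simp add: I_def)
qed

theorem theorem12:
  fixes k :: nat
    and V :: "'a set" and E :: "'a \<Rightarrow> 'a \<Rightarrow> bool" and v :: 'a
    and V' :: "'b set" and E' :: "'b \<Rightarrow> 'b \<Rightarrow> bool" and v0 :: 'b
    and M :: "'w measure" and \<tau> :: "'a \<Rightarrow> 'w \<Rightarrow> real"
    and M' :: "'x measure" and \<tau>' :: "'b \<Rightarrow> 'x \<Rightarrow> real"
  assumes "1 \<le> k"
    and "is_T k V E" and "v \<in> V"
    and "is_T_star k V' E' v0"
    and "iid_uniform M V \<tau>"
    and "iid_uniform M' V' \<tau>'"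
  shows "(\<forall>t\<in>{0..1}.
            \<P>(\<omega> in M. rsa E V (\<lambda>u. \<tau> u \<omega>) t v = 0) =
              1 / 2 * (1 + (\<P>(\<omega> in M'. rsa E' V' (\<lambda>u. \<tau>' u \<omega>) t v0 = 0))\<^sup>2) \<and>
            \<P>(\<omega> in M'. rsa E' V' (\<lambda>u. \<tau>' u \<omega>) t v0 = 0) =
              (if k \<ge> 2 then (1 + (real k - 1) * t) powr (- 1 / (real k - 1)) else exp (- t))) \<and>
         \<P>(\<omega> in M. rsa E V (\<lambda>u. \<tau> u \<omega>) 1 v = 0) =
           (if k \<ge> 2 then 1 / 2 * (1 + real k powr (- 2 / (real k - 1)))
            else 1 / 2 * (1 + exp (- 2)))"
proof -
  have degree: "finite {u. E w u}" if "simple_graph V E" "\<And>w. w \<in> V \<Longrightarrow> vertex_degree E w \<noteq> 0"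
    for V :: "'c set" and E w
  proof (cases "w \<in> V")
    case True
    then show ?thesis using that(2)[of w] by (auto simp: vertex_degree_def intro: card_ge_0_finite)
  next
    case False
    then have "{u. E w u} = {}" using that(1) by (auto simp: simple_graph_def)
    then show ?thesis by simp
  qed
  have T: "infinite_tree V E" "\<And>w. w \<in> V \<Longrightarrow> vertex_degree E w = k + 1"
    using assms(2) by (auto simp: is_T_def)
  have T': "infinite_tree V' E'" "v0 \<in> V'" "vertex_degree E' v0 = k"
      "\<And>w. w \<in> V' - {v0} \<Longrightarrow> vertex_degree E' w = k + 1"
    using assms(4) by (auto simp: is_T_star_def)
  have fin: "finite {u. E w u}" for w
    using T by (intro degree[of V]) (auto simp: infinite_tree_def)
  have deg': "vertex_degree E' w \<noteq> 0" if "w \<in> V'" for w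
    using T' assms(1) that by (cases "w = v0") auto
  have fin': "finite {u. E' w u}" for w
    using T'(1) deg' by (intro degree[of V']) (auto simp: infinite_tree_def)
  have star: "\<P>(\<omega> in M'. rsa E' V' (\<lambda>u. \<tau>' u \<omega>) t v0 = 0) = vacancy k t" if t: "t \<in> {0..1}" for t
    using prob_rsa_eq_0[OF assms(6) T'(1) fin' assms(1) T'(2,3) assms(1) t T'(4)]
      integral_unique[OF integral_vacancy_power(1)[OF assms(1), of t]] t by simp
  have full: "\<P>(\<omega> in M. rsa E V (\<lambda>u. \<tau> u \<omega>) t v = 0) = 1 / 2 * (1 + (vacancy k t)\<^sup>2)"
    if t: "t \<in> {0..1}" for t
  proof -
    have "\<P>(\<omega> in M. rsa E V (\<lambda>u. \<tau> u \<omega>) t v = 0) = 1 - integral {0..t} (\<lambda>x. vacancy k x ^ (k + 1))"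
      using assms(3) t T(2) by (intro prob_rsa_eq_0[OF assms(5) T(1) fin assms(1)]) auto
    also have "integral {0..t} (\<lambda>x. vacancy k x ^ (k + 1)) = (1 - (vacancy k t)\<^sup>2) / 2"
      using t by (intro integral_unique integral_vacancy_power(2) assms(1)) auto
    finally show ?thesis by (simp add: field_simps)
  qed
  have "(vacancy k 1)\<^sup>2 = (if k \<ge> 2 then real k powr (- 2 / (real k - 1)) else exp (- 2))"
    by (simp add: vacancy_def power2_eq_square powr_add[symmetric] exp_add[symmetric])
  then show ?thesis using star full by (simp add: vacancy_def[symmetric])
qed

end
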